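(* Let $u^n=\sum_{i=0}^RU^n_iY^n_i\in\mathcal M_R$ and let $u^{n+1}$, with intermediate modes $\tilde U^{n+1}_0,\tilde U^{n+1}=(\tilde U^{n+1}_1,\dots,\tilde U^{n+1}_R)$, be produced from $u^n$ by one step of the staggered Petrov-Galerkin DLR algorithm described in the context, with $\mathcal H=\mathcal H_1\otimes I$. Then $$\frac1{\triangle t}(u^{n+1}-u^n,\mathcal Hv)_{X,L^2_{\hat\mu}(\hat\Omega)}+\mathcal A^1_h(u^n,v)+\mathcal A^2_h(u^{n+1},v)=\mathcal F(\mathcal Hv)\qquad\forall v\in\mathcal T_{\tilde U^{n+1}(Y^n)^\top}\mathcal M_R .$$
   Context: **Spaces.** $X$ and $V$ are separable Hilbert spaces of functions on a domain $D\subset\mathbb R^d$ with $(V,X,V')$ a Gelfand triple; $V_h\subset V$ and $X_h\subset X$ are finite-dimensional (finite element) subspaces. $\hat\Omega=\{\omega_i\}_{i=1}^{N_C}$ carries the discrete probability measure $\hat\mu=\sum_im_i\delta_{\omega_i}$ with positive weights summing to $1$; $\mathbb E_{\hat\mu}[g]=\sum_im_ig(\omega_i)$; $L^2_{\hat\mu,0}(\hat\Omega)$ is the zero-mean subspace of $L^2_{\hat\mu}(\hat\Omega)$; $(u,v)_{X,L^2_{\hat\mu}(\hat\Omega)}=\mathbb E_{\hat\mu}[\langle u,v\rangle_X]$. $\mathcal H_1:V_h\to X_h$ is linear and $\mathcal H=\mathcal H_1\otimes I$ acts on $V_h\otimes L^2_{\hat\mu}(\hat\Omega)$. $\mathcal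 A^1_h,\mathcal A^2_h$ are bilinear forms on $V_h\otimes L^2_{\hat\mu}(\hat\Omega)$ (the explicitly and implicitly treated parts of the discrete operator) and $\mathcal F(w)=(f,w)_{X,L^2_{\hat\mu}(\hat\Omega)}$ with $f\in L^2_{\hat\mu}(\hat\Omega,X)$. **Manifold and tangent space.** Let $Y_0=1$. $\mathcal M_R$ is the set of $u=U_0Y_0+\sum_{i=1}^RU_iY_i$ with $U_i\in V_h$, $U_1,\dots,U_R$ linearly independent, $Y_i\in L^2_{\hat\mu,0}(\hat\Omega)$ for $i\ge1$, $\mathbb E_{\hat\mu}[Y_iY_j]=\delta_{ij}$. For such $U=(U_1,\dots,U_R)$, $Y=(Y_1,\dots,Y_R)$, $$\mathcal T_{UY^\top}\mathcal M_R=\Big\{\delta u_0Y_0+\sum_{i=1}^R(\delta u_iY_i+U_i\delta y_i):\ \delta u_i\in V_h,\ \delta y_i\in L^2_{\hat\mu,0}(\hat\Omega),\ \mathbb E_{\hat\mu}[\delta y_iY_j]=0\ \forall\,1\le i,j\le R\Big\}.$$ For $\mathcal Y^n=\operatorname{span}\{Y^n_1,\dots,Y^n_R\}$, $(\mathcal Y^n)^\perp$ is its orthogonal complement in $L^2_{\hat\mu,0}(\hat\Omega)$ and $\mathcal P^\perp_{\mathcal Y^n}$ the $L^2_{\hat\mu}$-orthogonal projection onto it. **Algorithm (one step).** Given $u^n=\sum_{i=0}^RU^n_iY^n_i\in\mathcal M_R$ (with $Y^n_0=Y_0$) and $\triangle t>0$: 1. Find $\tilde U^{n+1}_j\in V_h$,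 $0\le j\le R$, with $\triangle t^{-1}\langle\tilde U^{n+1}_j-U^n_j,\mathcal H_1v_h\rangle_X+\mathcal A^1_h(u^n,v_hY^n_j)+\mathcal A^2_h(u^{n+1},v_hY^n_j)=\mathcal F(\mathcal H_1v_hY^n_j)$ for all $v_h\in V_h$. 2. Find $\widetilde{\delta Y}^{n+1}_j\in(\mathcal Y^n)^\perp$, $1\le j\le R$, with $\triangle t^{-1}\sum_{i=1}^R\mathbb E_{\hat\mu}[\widetilde{\delta Y}^{n+1}_iz]\tilde W^{n+1}_{ij}+\mathcal A^1_h(u^n,\tilde U^{n+1}_j\mathcal P^\perp_{\mathcal Y^n}z)+\mathcal A^2_h(u^{n+1},\tilde U^{n+1}_j\mathcal P^\perp_{\mathcal Y^n}z)=\mathcal F(\mathcal H_1\tilde U^{n+1}_j\mathcal P^\perp_{\mathcal Y^n}z)$ for all $z\in L^2_{\hat\mu}(\hat\Omega)$, where $\tilde W^{n+1}_{ij}=\langle\tilde U^{n+1}_i,\mathcal H_1\tilde U^{n+1}_j\rangle_X$. 3. Set $\tilde Y^{n+1}_j=Y^n_j+\widetilde{\delta Y}^{n+1}_j$, $1\le j\le R$. 4. Find $\{U^{n+1}_i\}_{i=1}^R$, $\{Y^{n+1}_i\}_{i=1}^R$ with $\sum_{i=1}^RU^{n+1}_iY^{n+1}_i=\sum_{i=1}^R\tilde U^{n+1}_i\tilde Y^{n+1}_i$ and $\mathbb E_{\hat\mu}[Y^{n+1}_iY^{n+1}_j]=\delta_{ij}$. 5. $u^{n+1}=\tilde U^{n+1}_0Y_0+\sum_{i=1}^RU^{n+1}_iY^{n+1}_i$.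 (The steps are coupled through $u^{n+1}$ when $\mathcal A_h^2\neq0$.) It is assumed that the matrix $\tilde W^{n+1}=(\tilde W^{n+1}_{ij})$ is invertible. *)

theory Defs
  imports "HOL-Analysis.Analysis"
begin

(* Conventions.
   The sample points omega_1, ..., omega_{N_C} are the elements of a finite type 'w, and m gives
   their weights.  All weights are positive, so L^2 of the discrete measure with values in a vector
   space 'a is the space 'a ^ 'w of all functions on the sample points; products and the unit 1 of
   real ^ 'w are pointwise.
   The indices 1, ..., R are the elements of a finite type 'r; mode 0 is always kept separate, with
   Y_0 = 1. *)

section \<open>Spaces\<close>

(* (V, X, V'): V is continuously and densely embedded in X by the inclusion e.  The second half of
   the triple, X embedded in V' by x |-> (v |-> inner x (e v)), is determined by e. *)
definition gelfand_triple ::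
    "('v::{real_inner,polish_space} \<Rightarrow> 'x::{real_inner,polish_space}) \<Rightarrow> bool" where
  "gelfand_triple e \<longleftrightarrow> bounded_linear e \<and> inj e \<and> closure (range e) = UNIV"

definition finite_dim_subspace :: "'a::real_vector set \<Rightarrow> bool" where
  "finite_dim_subspace S \<longleftrightarrow> subspace S \<and> (\<exists>B. finite B \<and> S \<subseteq> span B)"

definition linear_on :: "'a::real_vector set \<Rightarrow> ('a \<Rightarrow> 'b::real_vector) \<Rightarrow> bool" where
  "linear_on S g \<longleftrightarrow>
     (\<forall>x\<in>S. \<forall>y\<in>S. g (x + y) = g x + g y) \<and> (\<forall>c. \<forall>x\<in>S. g (c *\<^sub>R x) = c *\<^sub>R g x)"

definition bilinear_form_on :: "'a::real_vector set \<Rightarrow> ('a \<Rightarrow> 'a \<Rightarrow> real) \<Rightarrow> bool" where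
  "bilinear_form_on S A \<longleftrightarrow>
     (\<forall>u\<in>S. linear_on S (\<lambda>v. A u v)) \<and> (\<forall>v\<in>S. linear_on S (\<lambda>u. A u v))"

definition prob_weights :: "('w::finite \<Rightarrow> real) \<Rightarrow> bool" where
  "prob_weights m \<longleftrightarrow> (\<forall>\<omega>. 0 < m \<omega>) \<and> (\<Sum>\<omega>\<in>UNIV. m \<omega>) = 1"

definition expect :: "('w::finite \<Rightarrow> real) \<Rightarrow> real ^ 'w \<Rightarrow> real" where
  "expect m g = (\<Sum>\<omega>\<in>UNIV. m \<omega> * g $ \<omega>)"

definition inner_XL2 ::
    "('w::finite \<Rightarrow> real) \<Rightarrow> 'x::real_inner ^ 'w \<Rightarrow> 'x ^ 'w \<Rightarrow> real" where
  "inner_XL2 m u v = expect m (\<chi> \<omega>. inner (u $ \<omega>) (v $ \<omega>))"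

definition L20 :: "('w::finite \<Rightarrow> real) \<Rightarrow> (real ^ 'w) set" where
  "L20 m = {y. expect m y = 0}"

definition tensor :: "'a::real_vector \<Rightarrow> real ^ 'w::finite \<Rightarrow> 'a ^ 'w" (infixl "\<otimes>" 72) where
  "v \<otimes> y = (\<chi> \<omega>. y $ \<omega> *\<^sub>R v)"

definition tensor_L2 :: "'a::real_vector set \<Rightarrow> ('a ^ 'w::finite) set" where
  "tensor_L2 S = span {v \<otimes> y | v y. v \<in> S}"

definition tensor_id :: "('a \<Rightarrow> 'b) \<Rightarrow> 'a ^ 'w::finite \<Rightarrow> 'b ^ 'w" where
  "tensor_id T u = (\<chi> \<omega>. T (u $ \<omega>))"

lemma tensor_id_tensor:
  assumes "linear_on S T" "v \<in> S"
  shows "tensor_id T (v \<otimes> y) = T v \<otimes> y"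
  using assms by (simp add: tensor_id_def tensor_def linear_on_def vec_eq_iff)

lemma tensor_L2_eq_pointwise:
  assumes "subspace S"
  shows "tensor_L2 S = {u :: 'a::real_vector ^ 'w::finite. \<forall>\<omega>. u $ \<omega> \<in> S}"
proof
  have "subspace {u :: 'a ^ 'w. \<forall>\<omega>. u $ \<omega> \<in> S}"
    using assms by (auto simp: subspace_def)
  moreover have "{v \<otimes> y | v y. v \<in> S} \<subseteq> {u :: 'a ^ 'w. \<forall>\<omega>. u $ \<omega> \<in> S}"
    using assms by (auto simp: tensor_def subspace_def)
  ultimately show "tensor_L2 S \<subseteq> {u :: 'a ^ 'w. \<forall>\<omega>. u $ \<omega> \<in> S}"
    unfolding tensor_L2_def by (rule span_minimal[rotated])
next
  show "{u :: 'a ^ 'w. \<forall>\<omega>. u $ \<omega> \<in> S} \<subseteq> tensor_L2 S"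
  proof
    fix u :: "'a ^ 'w" assume u: "u \<in> {u. \<forall>\<omega>. u $ \<omega> \<in> S}"
    have "u = (\<Sum>\<omega>\<in>UNIV. (u $ \<omega>) \<otimes> axis \<omega> 1)"
      by (auto simp: vec_eq_iff tensor_def axis_def if_distrib[of "\<lambda>c. c *\<^sub>R _"] cong: if_cong)
    also have "\<dots> \<in> tensor_L2 S"
      unfolding tensor_L2_def using u by (intro span_sum span_base) auto
    finally show "u \<in> tensor_L2 S" .
  qed
qed

section \<open>Orthogonality in $L^2$\<close>

definition orthonormal :: "('w::finite \<Rightarrow> real) \<Rightarrow> ('r \<Rightarrow> real ^ 'w) \<Rightarrow> bool" where
  "orthonormal m Y \<longleftrightarrow> (\<forall>i j. expect m (Y i * Y j) = (if i = j then 1 else 0))"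

(* The complement is taken inside the zero-mean space. *)
definition orth_compl :: "('w::finite \<Rightarrow> real) \<Rightarrow> (real ^ 'w) set \<Rightarrow> (real ^ 'w) set" where
  "orth_compl m S = {z \<in> L20 m. \<forall>y\<in>S. expect m (z * y) = 0}"

definition orth_proj :: "('w::finite \<Rightarrow> real) \<Rightarrow> (real ^ 'w) set \<Rightarrow> real ^ 'w \<Rightarrow> real ^ 'w" where
  "orth_proj m S z = (THE p. p \<in> S \<and> (\<forall>q\<in>S. expect m ((z - p) * q) = 0))"

lemma expect_simps:
  "expect m (x + y) = expect m x + expect m y"
  "expect m (x - y) = expect m x - expect m y"
  "expect m (c *\<^sub>R x) = c * expect m x"
  "expect m 0 = 0"
  by (simp_all add: expect_def algebra_simps sum.distrib sum_subtractf sum_distrib_left)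

lemma subspace_orth_compl: "subspace (orth_compl m S)"
  by (auto simp: subspace_def orth_compl_def L20_def expect_simps distrib_right)

lemma orth_proj:
  assumes m: "prob_weights m" and S: "subspace S"
  shows "orth_proj m S z \<in> S" "q \<in> S \<Longrightarrow> expect m ((z - orth_proj m S z) * q) = 0"
proof -
  define T :: "real ^ 'a \<Rightarrow> real ^ 'a" where "T x = (\<chi> \<omega>. sqrt (m \<omega>) * x $ \<omega>)" for x
  have pos: "0 < m \<omega>" for \<omega> using m by (simp add: prob_weights_def)
  have linT: "linear T" by (rule linearI) (simp_all add: T_def vec_eq_iff algebra_simps)
  have E: "expect m (x * y) = inner (T x) (T y)" for x y
  proof -
    have "m \<omega> * (x $ \<omega> * y $ \<omega>) = sqrt (m \<omega>) * x $ \<omega> * (sqrt (m \<omega>) * y $ \<omega>)" for \<omega>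
    proof -
      have "sqrt (m \<omega>) * x $ \<omega> * (sqrt (m \<omega>) * y $ \<omega>) = (sqrt (m \<omega>) * sqrt (m \<omega>)) * (x $ \<omega> * y $ \<omega>)"
        by (simp only: mult_ac)
      then show ?thesis using pos[of \<omega>] by simp
    qed
    then show ?thesis
      by (simp only: expect_def T_def inner_vec_def vec_lambda_beta inner_real_def
          vector_mult_component)
  qed
  have nz: "m \<omega> \<noteq> 0" for \<omega> using pos[of \<omega>] by simp
  have injT: "T x = 0 \<Longrightarrow> x = 0" for x
    by (simp add: T_def vec_eq_iff nz)
  have sub: "subspace (T ` S)" using linT S by (rule linear_subspace_image)
  then have "span (T ` S) = T ` S" by (simp only: span_eq_iff)
  then obtain a b where ab: "a \<in> T ` S" "\<And>w. w \<in> T ` S \<Longrightarrow> orthogonal b w" "T z = a + b"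
    using orthogonal_subspace_decomp_exists[of "T ` S" "T z"] by metis
  then obtain p where p: "p \<in> S" "a = T p" by blast
  have orth: "expect m ((z - p) * q) = 0" if "q \<in> S" for q
  proof -
    have "T (z - p) = b" using ab(3) p(2) by (simp add: linear_diff[OF linT])
    moreover have "orthogonal b (T q)" using ab(2) that by blast
    ultimately show ?thesis by (simp only: E orthogonal_def)
  qed
  have uniq: "p' = p" if "p' \<in> S" "\<forall>q\<in>S. expect m ((z - p') * q) = 0" for p'
  proof -
    have d: "p' - p \<in> S" using that p S by (simp add: subspace_diff)
    have "(p' - p) * (p' - p) = (z - p) * (p' - p) - (z - p') * (p' - p)"
      by (simp add: algebra_simps)
    then have "expect m ((p' - p) * (p' - p))
        = expect m ((z - p) * (p' - p)) - expect m ((z - p') * (p' - p))"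
      by (simp only: expect_simps)
    also have "\<dots> = 0" using orth[OF d] that(2) d by simp
    finally show ?thesis using injT[of "p' - p"] by (simp only: E inner_eq_zero_iff) simp
  qed
  have *: "orth_proj m S z = p"
    unfolding orth_proj_def
  proof (rule the_equality)
    show "p \<in> S \<and> (\<forall>q\<in>S. expect m ((z - p) * q) = 0)" using p(1) orth by blast
  qed (use uniq in blast)
  show "orth_proj m S z \<in> S" unfolding * by (rule p(1))
  show "expect m ((z - orth_proj m S z) * q) = 0" if "q \<in> S" unfolding * using that by (rule orth)
qed

section \<open>The manifold of rank-R functions\<close>

definition is_dlr_repr :: "('w::finite \<Rightarrow> real) \<Rightarrow> 'v::real_vector set \<Rightarrow> 'v ^ 'w
    \<Rightarrow> 'v \<Rightarrow> ('r::finite \<Rightarrow> 'v) \<Rightarrow> ('r \<Rightarrow> real ^ 'w) \<Rightarrow> bool" where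
  "is_dlr_repr m Vh u U0 U Y \<longleftrightarrow>
     U0 \<in> Vh \<and> (\<forall>i. U i \<in> Vh) \<and> inj U \<and> independent (range U) \<and>
     (\<forall>i. Y i \<in> L20 m) \<and> orthonormal m Y \<and>
     u = U0 \<otimes> 1 + (\<Sum>i\<in>UNIV. U i \<otimes> Y i)"

(* The rank R is the cardinality of the index type 'r. *)
definition dlr_manifold ::
    "'r::finite itself \<Rightarrow> ('w::finite \<Rightarrow> real) \<Rightarrow> 'v::real_vector set \<Rightarrow> ('v ^ 'w) set" where
  "dlr_manifold _ m Vh = {u. \<exists>U0 (U :: 'r \<Rightarrow> 'v) Y. is_dlr_repr m Vh u U0 U Y}"

lemma dlr_manifoldI:
  fixes U :: "'r::finite \<Rightarrow> 'v::real_vector"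
  assumes "is_dlr_repr m Vh u U0 U Y"
  shows "u \<in> dlr_manifold TYPE('r) m Vh"
  using assms by (auto simp: dlr_manifold_def)

definition tangent_space :: "('w::finite \<Rightarrow> real) \<Rightarrow> 'v::real_vector set
    \<Rightarrow> ('r::finite \<Rightarrow> 'v) \<Rightarrow> ('r \<Rightarrow> real ^ 'w) \<Rightarrow> ('v ^ 'w) set" where
  "tangent_space m Vh U Y =
     {du0 \<otimes> 1 + (\<Sum>i\<in>UNIV. du i \<otimes> Y i + U i \<otimes> dy i) | du0 du dy.
        du0 \<in> Vh \<and> (\<forall>i. du i \<in> Vh) \<and> (\<forall>i. dy i \<in> L20 m) \<and>
        (\<forall>i j. expect m (dy i * Y j) = 0)}"

section \<open>One step of the staggered algorithm\<close>

(* The equation of step 1 for a single mode, with old value U, new value Ut and stochastic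
   mode Y; un and un1 are the old and new iterates. *)
definition deterministic_eq ::
  "('w::finite \<Rightarrow> real) \<Rightarrow> ('v::real_vector \<Rightarrow> 'x::real_inner) \<Rightarrow> 'v set \<Rightarrow> ('v \<Rightarrow> 'x)
   \<Rightarrow> ('v ^ 'w \<Rightarrow> 'v ^ 'w \<Rightarrow> real) \<Rightarrow> ('v ^ 'w \<Rightarrow> 'v ^ 'w \<Rightarrow> real) \<Rightarrow> 'x ^ 'w \<Rightarrow> real
   \<Rightarrow> 'v ^ 'w \<Rightarrow> 'v ^ 'w \<Rightarrow> 'v \<Rightarrow> 'v \<Rightarrow> real ^ 'w \<Rightarrow> bool" where
  "deterministic_eq m e Vh H1 A1 A2 f dt un un1 U Ut Y \<longleftrightarrow>
     (\<forall>vh\<in>Vh. (1 / dt) * inner (e (Ut - U)) (H1 vh) + A1 un (vh \<otimes> Y) + A2 un1 (vh \<otimes> Y)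
        = inner_XL2 m f (H1 vh \<otimes> Y))"

definition W_mat :: "('v \<Rightarrow> 'x::real_inner) \<Rightarrow> ('v \<Rightarrow> 'x) \<Rightarrow> ('r::finite \<Rightarrow> 'v) \<Rightarrow> real ^ 'r ^ 'r" where
  "W_mat e H1 Ut = (\<chi> i j. inner (e (Ut i)) (H1 (Ut j)))"

(* The stages are coupled through un1, which enters steps 1 and 2 and is only determined by
   step 5, so a step is a relation between all of its inputs and outputs.  Ut0, Ut, dY, Yt are the
   quantities with a tilde; U1, Y1, un1 are the new modes and the new iterate. *)
definition dlr_step ::
  "('w::finite \<Rightarrow> real) \<Rightarrow> ('v::real_vector \<Rightarrow> 'x::real_inner) \<Rightarrow> 'v set \<Rightarrow> ('v \<Rightarrow> 'x)
   \<Rightarrow> ('v ^ 'w \<Rightarrow> 'v ^ 'w \<Rightarrow> real) \<Rightarrow> ('v ^ 'w \<Rightarrow> 'v ^ 'w \<Rightarrow> real) \<Rightarrow> 'x ^ 'w \<Rightarrow> real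
   \<Rightarrow> 'v ^ 'w \<Rightarrow> 'v \<Rightarrow> ('r::finite \<Rightarrow> 'v) \<Rightarrow> ('r \<Rightarrow> real ^ 'w)
   \<Rightarrow> 'v \<Rightarrow> ('r \<Rightarrow> 'v) \<Rightarrow> ('r \<Rightarrow> real ^ 'w) \<Rightarrow> ('r \<Rightarrow> real ^ 'w)
   \<Rightarrow> ('r \<Rightarrow> 'v) \<Rightarrow> ('r \<Rightarrow> real ^ 'w) \<Rightarrow> 'v ^ 'w \<Rightarrow> bool" where
  "dlr_step m e Vh H1 A1 A2 f dt un U0 U Y Ut0 Ut dY Yt U1 Y1 un1 \<longleftrightarrow>
     (Ut0 \<in> Vh \<and> deterministic_eq m e Vh H1 A1 A2 f dt un un1 U0 Ut0 1) \<and>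
     (\<forall>j. Ut j \<in> Vh \<and> deterministic_eq m e Vh H1 A1 A2 f dt un un1 (U j) (Ut j) (Y j)) \<and>
     (let Yperp = orth_compl m (span (range Y)) in
       \<forall>j. dY j \<in> Yperp \<and>
         (\<forall>z. (1 / dt) * (\<Sum>i\<in>UNIV. expect m (dY i * z) * W_mat e H1 Ut $ i $ j)
            + A1 un (Ut j \<otimes> orth_proj m Yperp z)
            + A2 un1 (Ut j \<otimes> orth_proj m Yperp z)
            = inner_XL2 m f (H1 (Ut j) \<otimes> orth_proj m Yperp z))) \<and>
     (\<forall>j. Yt j = Y j + dY j) \<and>
     (\<forall>i. U1 i \<in> Vh) \<and> orthonormal m Y1 \<and>
     (\<Sum>i\<in>UNIV. U1 i \<otimes> Y1 i) = (\<Sum>i\<in>UNIV. Ut i \<otimes> Yt i) \<and>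
     un1 = Ut0 \<otimes> 1 + (\<Sum>i\<in>UNIV. U1 i \<otimes> Y1 i)"

end

theory Submission
  imports Defs
begin

text \<open>
  The increment of one step splits into three groups of elementary tensors,
  \[ u^{n+1} - u^n = (\tilde U_0 - U_0) \otimes 1 + \sum_i (\tilde U_i - U_i) \otimes Y_i
       + \sum_i \tilde U_i \otimes \delta Y_i , \]
  because the reorthonormalisation of step 4 changes the factors but not the product, and
  $\tilde Y_i = Y_i + \delta Y_i$. The stochastic factors of the three groups lie in three mutually
  orthogonal subspaces of $L^2$: the constants, the span of the $Y_i$ (where the $Y_i$ are even
  orthonormal), and the orthogonal complement of that span among the zero-mean functions. A tangent
  vector at $\tilde U Y^\top$ is a sum of elementary tensors whose stochastic factors lie in the same
  three subspaces. Testing with one such tensor therefore sees only one group of the increment, and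
  the equation that is left is exactly one equation of the algorithm: step 1 with $j = 0$ for
  $v \otimes 1$, step 1 with $j$ for $v \otimes Y_j$, and step 2 with $j$ for $\tilde U_j \otimes z$,
  where the projection in step 2 fixes $z$.

  It remains to add these equations up. The defect of the variational equation is linear in the test
  function (\<open>linear_on_residual\<close>), so it vanishes on the tangent space once it vanishes on the three
  families of tensors (\<open>linear_on_eq_0_on_tangent_space\<close>).
\<close>

section \<open>Linear maps on subspaces and elementary tensors\<close>

lemma linear_on_0:
  assumes "linear_on S g" "subspace S"
  shows "g 0 = 0"
proof -
  have "g (0 *\<^sub>R 0) = 0 *\<^sub>R g 0"
    using assms unfolding linear_on_def by (metis subspace_0)
  then show ?thesis by simp
qed

lemma linear_on_sum:
  assumes g: "linear_on S g" and S: "subspace S" and x: "\<And>i. i \<in> I \<Longrightarrow> x i \<in> S"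
  shows "g (\<Sum>i\<in>I. x i) = (\<Sum>i\<in>I. g (x i))"
  using x
proof (induction I rule: infinite_finite_induct)
  case (insert i I)
  then have "(\<Sum>k\<in>I. x k) \<in> S" using S by (intro subspace_sum) auto
  with insert g show ?case by (simp add: linear_on_def)
qed (simp_all add: linear_on_0[OF g S])

lemma tensor_in_tensor_L2: "v \<in> S \<Longrightarrow> v \<otimes> y \<in> tensor_L2 S"
  unfolding tensor_L2_def by (rule span_base) blast

lemma subspace_tensor_L2: "subspace (tensor_L2 S)"
  unfolding tensor_L2_def by (rule subspace_span)

lemma tensor_add_right: "v \<otimes> (y + z) = v \<otimes> y + v \<otimes> z"
  by (simp add: tensor_def vec_eq_iff scaleR_add_left)

lemma tensor_diff_left: "(v - w) \<otimes> y = v \<otimes> y - w \<otimes> y"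
  by (simp add: tensor_def vec_eq_iff scaleR_diff_right)

lemma dlr_repr_in_tensor_L2:
  assumes "is_dlr_repr m Vh u U0 U Y"
  shows "u \<in> tensor_L2 Vh"
proof -
  have "U0 \<otimes> 1 + (\<Sum>i\<in>UNIV. U i \<otimes> Y i) \<in> tensor_L2 Vh"
    using assms unfolding is_dlr_repr_def
    by (intro subspace_add[OF subspace_tensor_L2] subspace_sum[OF subspace_tensor_L2]
        tensor_in_tensor_L2) auto
  then show ?thesis using assms by (simp add: is_dlr_repr_def)
qed

section \<open>The inner product of tensors\<close>

lemma inner_XL2_tensor: "inner_XL2 m (a \<otimes> y) (b \<otimes> z) = inner a b * expect m (y * z)"
  by (simp add: inner_XL2_def tensor_def expect_def sum_distrib_left algebra_simps)

lemma inner_XL2_add_left: "inner_XL2 m (u + u') v = inner_XL2 m u v + inner_XL2 m u' v"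
  by (simp add: inner_XL2_def expect_def inner_add_left algebra_simps sum.distrib)

lemma inner_XL2_add_right: "inner_XL2 m u (v + v') = inner_XL2 m u v + inner_XL2 m u v'"
  by (simp add: inner_XL2_def expect_def inner_add_right algebra_simps sum.distrib)

lemma inner_XL2_scaleR_right: "inner_XL2 m u (c *\<^sub>R v) = c * inner_XL2 m u v"
  by (simp add: inner_XL2_def expect_def algebra_simps sum_distrib_left)

lemma inner_XL2_sum_left: "inner_XL2 m (\<Sum>i\<in>I. u i) v = (\<Sum>i\<in>I. inner_XL2 m (u i) v)"
proof (induction I rule: infinite_finite_induct)
  case (insert i I)
  then show ?case by (simp add: inner_XL2_add_left)
qed (simp_all add: inner_XL2_def expect_def)

lemma linear_on_inner_XL2_tensor_id:
  fixes H :: "'a::real_vector \<Rightarrow> 'b::real_inner" and m :: "'c::finite \<Rightarrow> real"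
  assumes H: "linear_on S H" and S: "subspace S"
  shows "linear_on (tensor_L2 S) (\<lambda>v. inner_XL2 m u (tensor_id H v))"
proof -
  have "tensor_id H (v + w) = tensor_id H v + tensor_id H w"
    if "v \<in> tensor_L2 S" "w \<in> tensor_L2 S" for v w :: "'a ^ 'c"
    using that H by (auto simp: tensor_L2_eq_pointwise[OF S] tensor_id_def linear_on_def vec_eq_iff)
  moreover have "tensor_id H (c *\<^sub>R v) = c *\<^sub>R tensor_id H v"
    if "v \<in> tensor_L2 S" for c and v :: "'a ^ 'c"
    using that H by (auto simp: tensor_L2_eq_pointwise[OF S] tensor_id_def linear_on_def vec_eq_iff)
  ultimately show ?thesis
    by (simp add: linear_on_def inner_XL2_add_right inner_XL2_scaleR_right)
qed

lemma linear_imp_linear_on: "linear g \<Longrightarrow> linear_on S g"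
  by (simp add: linear_on_def linear_add linear_scale)

lemma tensor_id_linear_tensor: "linear T \<Longrightarrow> tensor_id T (a \<otimes> y) = T a \<otimes> y"
  by (rule tensor_id_tensor[where S = UNIV]) (simp_all add: linear_imp_linear_on)

lemma linear_tensor_id:
  assumes "linear T"
  shows "linear (tensor_id T)"
  by (rule linearI)
    (simp_all add: tensor_id_def vec_eq_iff linear_add[OF assms] linear_scale[OF assms])

text \<open>
  The increment of a step, tested with an elementary tensor. Each of its three groups of terms
  enters through one expectation only, on which the orthogonality relations can act.
\<close>

lemma inner_XL2_increment_tensor:
  assumes e: "linear e"
  shows "inner_XL2 m
      (tensor_id e (a \<otimes> 1 + (\<Sum>i\<in>I. b i \<otimes> Y i) + (\<Sum>i\<in>I. c i \<otimes> Z i))) (h \<otimes> y)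
    = inner (e a) h * expect m y + (\<Sum>i\<in>I. inner (e (b i)) h * expect m (Y i * y))
      + (\<Sum>i\<in>I. inner (e (c i)) h * expect m (Z i * y))"
  by (simp add: linear_add[OF linear_tensor_id[OF e]] linear_sum[OF linear_tensor_id[OF e]]
      tensor_id_linear_tensor[OF e] inner_XL2_add_left inner_XL2_sum_left inner_XL2_tensor)

section \<open>Orthogonal complement and projection\<close>

lemma mem_orth_compl_span_iff:
  "z \<in> orth_compl m (span (range Y)) \<longleftrightarrow> z \<in> L20 m \<and> (\<forall>j. expect m (z * Y j) = 0)"
proof -
  have "subspace {y. expect m (z * y) = 0}"
    by (auto simp: subspace_def expect_simps distrib_left)
  then have "span (range Y) \<subseteq> {y. expect m (z * y) = 0}" if "\<forall>j. expect m (z * Y j) = 0"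
    using that by (intro span_minimal) auto
  then show ?thesis
    by (auto simp: orth_compl_def intro: span_base)
qed

lemma expect_mult_self_eq_0:
  assumes "prob_weights m" "expect m (x * x) = 0"
  shows "x = 0"
proof -
  have pos: "0 < m \<omega>" for \<omega> using assms(1) by (simp add: prob_weights_def)
  have "\<forall>\<omega>\<in>UNIV. m \<omega> * (x $ \<omega> * x $ \<omega>) = 0"
    using assms(2) pos by (subst sum_nonneg_eq_0_iff[symmetric]) (auto simp: expect_def less_imp_le)
  then have "x $ \<omega> = 0" for \<omega>
    using pos[of \<omega>] by (metis UNIV_I less_irrefl mult_eq_0_iff)
  then show ?thesis by (simp add: vec_eq_iff)
qed

lemma orth_proj_fixes:
  assumes m: "prob_weights m" and S: "subspace S" and z: "z \<in> S"
  shows "orth_proj m S z = z"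
proof -
  have "z - orth_proj m S z \<in> S"
    using orth_proj(1)[OF m S] S z by (simp add: subspace_diff)
  then have "expect m ((z - orth_proj m S z) * (z - orth_proj m S z)) = 0"
    by (rule orth_proj(2)[OF m S])
  then show ?thesis using expect_mult_self_eq_0[OF m] by fastforce
qed

section \<open>The residual of the variational equation\<close>

definition residual ::
  "('w::finite \<Rightarrow> real) \<Rightarrow> ('v::real_vector \<Rightarrow> 'x::real_inner) \<Rightarrow> ('v \<Rightarrow> 'x)
   \<Rightarrow> ('v ^ 'w \<Rightarrow> 'v ^ 'w \<Rightarrow> real) \<Rightarrow> ('v ^ 'w \<Rightarrow> 'v ^ 'w \<Rightarrow> real) \<Rightarrow> 'x ^ 'w \<Rightarrow> real
   \<Rightarrow> 'v ^ 'w \<Rightarrow> 'v ^ 'w \<Rightarrow> 'v ^ 'w \<Rightarrow> real" where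
  "residual m e H1 A1 A2 f dt un un1 v =
     (1 / dt) * inner_XL2 m (tensor_id e (un1 - un)) (tensor_id H1 v) + A1 un v + A2 un1 v
       - inner_XL2 m f (tensor_id H1 v)"

lemma linear_on_residual:
  assumes Vh: "subspace Vh" and H1: "linear_on Vh H1"
    and A1: "bilinear_form_on (tensor_L2 Vh) A1" and A2: "bilinear_form_on (tensor_L2 Vh) A2"
    and un: "un \<in> tensor_L2 Vh" and un1: "un1 \<in> tensor_L2 Vh"
  shows "linear_on (tensor_L2 Vh) (residual m e H1 A1 A2 f dt un un1)"
proof -
  note inner_linear = linear_on_inner_XL2_tensor_id[OF H1 Vh, of m]
  have "linear_on (tensor_L2 Vh) (A1 un)" "linear_on (tensor_L2 Vh) (A2 un1)"
    using A1 A2 un un1 by (auto simp: bilinear_form_on_def)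
  then show ?thesis
    using inner_linear[of "tensor_id e (un1 - un)"] inner_linear[of f]
    unfolding linear_on_def residual_def by (simp add: algebra_simps add_divide_distrib)
qed

text \<open>
  Every tangent vector is a sum of tensors from three families. In the third family only the modes
  \<open>U j\<close> of the base point occur as deterministic factors. Step 2 of the algorithm tests with the
  updated deterministic modes and the old stochastic ones, and this is why the tangent space of the
  variational formulation is taken at $\tilde U Y^\top$.
\<close>

lemma linear_on_eq_0_on_tangent_space:
  fixes G :: "'v::real_vector ^ 'w::finite \<Rightarrow> real" and U :: "'r::finite \<Rightarrow> 'v"
  assumes G: "linear_on (tensor_L2 Vh) G" and U: "\<And>j. U j \<in> Vh"
    and mean: "\<And>v. v \<in> Vh \<Longrightarrow> G (v \<otimes> 1) = 0"
    and modes: "\<And>v j. v \<in> Vh \<Longrightarrow> G (v \<otimes> Y j) = 0"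
    and compl: "\<And>z j. z \<in> orth_compl m (span (range Y)) \<Longrightarrow> G (U j \<otimes> z) = 0"
    and v: "v \<in> tangent_space m Vh U Y"
  shows "G v = 0"
proof -
  obtain a b z where v_eq: "v = a \<otimes> 1 + (\<Sum>i\<in>UNIV. b i \<otimes> Y i + U i \<otimes> z i)"
    and a: "a \<in> Vh" and b: "\<And>i. b i \<in> Vh"
    and z: "\<And>i. z i \<in> orth_compl m (span (range Y))"
    using v unfolding tangent_space_def mem_orth_compl_span_iff by blast
  have add: "G (x + y) = G x + G y" if "x \<in> tensor_L2 Vh" "y \<in> tensor_L2 Vh" for x y
    using G that by (simp add: linear_on_def)
  have summand: "b i \<otimes> Y i + U i \<otimes> z i \<in> tensor_L2 Vh" for i
    by (intro subspace_add[OF subspace_tensor_L2] tensor_in_tensor_L2 b U)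
  have "G v = G (a \<otimes> 1) + G (\<Sum>i\<in>UNIV. b i \<otimes> Y i + U i \<otimes> z i)"
    unfolding v_eq
    by (intro add tensor_in_tensor_L2 a subspace_sum[OF subspace_tensor_L2] summand)
  also have "\<dots> = G (a \<otimes> 1) + (\<Sum>i\<in>UNIV. G (b i \<otimes> Y i) + G (U i \<otimes> z i))"
    by (simp add: linear_on_sum[OF G subspace_tensor_L2] summand add tensor_in_tensor_L2 b U)
  also have "\<dots> = 0" by (simp add: mean[OF a] modes[OF b] compl[OF z])
  finally show ?thesis .
qed

section \<open>One step of the algorithm\<close>

lemma dlr_step_increment:
  assumes "is_dlr_repr m Vh un U0 U Y"
    and "dlr_step m e Vh H1 A1 A2 f dt un U0 U Y Ut0 Ut dY Yt U1 Y1 un1"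
  shows "un1 - un = (Ut0 - U0) \<otimes> 1 + (\<Sum>i\<in>UNIV. (Ut i - U i) \<otimes> Y i) + (\<Sum>i\<in>UNIV. Ut i \<otimes> dY i)"
proof -
  have "un1 = Ut0 \<otimes> 1 + (\<Sum>i\<in>UNIV. Ut i \<otimes> Yt i)" and "\<And>i. Yt i = Y i + dY i"
    using assms(2) unfolding dlr_step_def by simp_all
  then show ?thesis
    using assms(1)
    by (simp add: is_dlr_repr_def tensor_diff_left tensor_add_right sum.distrib sum_subtractf)
qed

lemma dlr_step_in_tensor_L2:
  assumes "dlr_step m e Vh H1 A1 A2 f dt un U0 U Y Ut0 Ut dY Yt U1 Y1 un1"
  shows "un1 \<in> tensor_L2 Vh"
proof -
  have un1: "un1 = Ut0 \<otimes> 1 + (\<Sum>i\<in>UNIV. U1 i \<otimes> Y1 i)" and "Ut0 \<in> Vh" "\<And>i. U1 i \<in> Vh"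
    using assms unfolding dlr_step_def by simp_all
  then show ?thesis
    unfolding un1
    by (intro subspace_add[OF subspace_tensor_L2] subspace_sum[OF subspace_tensor_L2]
        tensor_in_tensor_L2)
qed

theorem theorem3p1:
  fixes e :: "'v::{real_inner,polish_space} \<Rightarrow> 'x::{real_inner,polish_space}"
    and Vh :: "'v set" and Xh :: "'x set"
    and m :: "'w::finite \<Rightarrow> real"
    and H1 :: "'v \<Rightarrow> 'x"
    and A1 A2 :: "'v ^ 'w \<Rightarrow> 'v ^ 'w \<Rightarrow> real"
    and f :: "'x ^ 'w"
    and dt :: real
    and un un1 :: "'v ^ 'w"
    and U0 Ut0 :: 'v
    and U Ut U1 :: "'r::finite \<Rightarrow> 'v"
    and Y dY Yt Y1 :: "'r \<Rightarrow> real ^ 'w"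
  assumes "gelfand_triple e"
    and "finite_dim_subspace Vh"
    and "finite_dim_subspace Xh"
    and "prob_weights m"
    and "linear_on Vh H1" and "H1 ` Vh \<subseteq> Xh"
    and "bilinear_form_on (tensor_L2 Vh) A1"
    and "bilinear_form_on (tensor_L2 Vh) A2"
    and "dt > 0"
    and "is_dlr_repr m Vh un U0 U Y"
    and "dlr_step m e Vh H1 A1 A2 f dt un U0 U Y Ut0 Ut dY Yt U1 Y1 un1"
    and "invertible (W_mat e H1 Ut)"
  shows "\<forall>v\<in>tangent_space m Vh Ut Y.
    (1 / dt) * inner_XL2 m (tensor_id e (un1 - un)) (tensor_id H1 v) + A1 un v + A2 un1 v
      = inner_XL2 m f (tensor_id H1 v)"
proof
  fix v assume v: "v \<in> tangent_space m Vh Ut Y"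
  let ?perp = "orth_compl m (span (range Y))"
  let ?G = "residual m e H1 A1 A2 f dt un un1"
  note m = assms(4) and H1 = assms(5) and repr = assms(10) and step = assms(11)
  have e: "linear e"
    using assms(1) by (simp add: gelfand_triple_def bounded_linear.linear)
  have Vh: "subspace Vh" using assms(2) by (simp add: finite_dim_subspace_def)

  have step0: "deterministic_eq m e Vh H1 A1 A2 f dt un un1 U0 Ut0 1"
    and step1: "\<And>j. deterministic_eq m e Vh H1 A1 A2 f dt un un1 (U j) (Ut j) (Y j)"
    and Ut: "\<And>j. Ut j \<in> Vh" and dY: "\<And>j. dY j \<in> ?perp"
    and step2: "\<And>j z. (1 / dt) * (\<Sum>i\<in>UNIV. expect m (dY i * z) * W_mat e H1 Ut $ i $ j)
        + A1 un (Ut j \<otimes> orth_proj m ?perp z) + A2 un1 (Ut j \<otimes> orth_proj m ?perp z)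
        = inner_XL2 m f (H1 (Ut j) \<otimes> orth_proj m ?perp z)"
    using step unfolding dlr_step_def Let_def by blast+

  have E1: "expect m 1 = 1" using m by (simp add: expect_def prob_weights_def)
  have EY: "expect m (Y i) = 0" and EYY: "expect m (Y i * Y j) = (if i = j then 1 else 0)" for i j
    using repr by (simp_all add: is_dlr_repr_def L20_def orthonormal_def)
  have Eperp: "expect m z = 0" "expect m (z * Y j) = 0" "expect m (Y j * z) = 0"
    if "z \<in> ?perp" for z j
    using that by (simp_all add: mem_orth_compl_span_iff L20_def mult.commute[of "Y j"])

  have G_tensor: "?G (w \<otimes> y) = (1 / dt) * (inner (e (Ut0 - U0)) (H1 w) * expect m y
        + (\<Sum>i\<in>UNIV. inner (e (Ut i - U i)) (H1 w) * expect m (Y i * y))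
        + (\<Sum>i\<in>UNIV. inner (e (Ut i)) (H1 w) * expect m (dY i * y)))
      + A1 un (w \<otimes> y) + A2 un1 (w \<otimes> y) - inner_XL2 m f (H1 w \<otimes> y)" if "w \<in> Vh" for w y
    unfolding residual_def dlr_step_increment[OF repr step] tensor_id_tensor[OF H1 that]
      inner_XL2_increment_tensor[OF e] ..

  have "?G v = 0"
  proof (rule linear_on_eq_0_on_tangent_space[OF _ Ut _ _ _ v])
    show "linear_on (tensor_L2 Vh) ?G"
      using Vh H1 assms(7,8) dlr_repr_in_tensor_L2[OF repr] dlr_step_in_tensor_L2[OF step]
      by (rule linear_on_residual)
  next
    fix w assume w: "w \<in> Vh"
    show "?G (w \<otimes> 1) = 0"
      using step0 w unfolding deterministic_eq_def
      by (simp add: G_tensor E1 EY Eperp[OF dY])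
  next
    fix w j assume w: "w \<in> Vh"
    have "(\<Sum>i\<in>UNIV. inner (e (Ut i - U i)) (H1 w) * expect m (Y i * Y j))
        = inner (e (Ut j - U j)) (H1 w)"
      by (simp add: EYY if_distrib cong: if_cong)
    then show "?G (w \<otimes> Y j) = 0"
      using step1[of j] w unfolding deterministic_eq_def
      by (simp add: G_tensor EY Eperp[OF dY])
  next
    fix z j assume z: "z \<in> ?perp"
    have "orth_proj m ?perp z = z"
      using m subspace_orth_compl z by (rule orth_proj_fixes)
    then show "?G (Ut j \<otimes> z) = 0"
      using step2[where z = z and j = j] by (simp add: G_tensor[OF Ut] Eperp[OF z] W_mat_def mult.commute)
  qed
  then show "(1 / dt) * inner_XL2 m (tensor_id e (un1 - un)) (tensor_id H1 v) + A1 un v + A2 un1 v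
      = inner_XL2 m f (tensor_id H1 v)"
    by (simp add: residual_def)
qed

end
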